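(* Let $m\ge3$ be odd, $q=2^i$ with $\gcd(i,m)=1$, and $a\in\mathbb{F}_{2^m}^*$. Define $H_a:\mathbb{F}_{2^m}^3\to\mathbb{F}_{2^m}^3$ by \[H_a(x,y,z)=\bigl(x^{q+1}+axy^q+yz^q,\; xy^q+z^{q+1},\; x^qz+y^{q+1}+ay^qz\bigr).\] Then $H_a$ is a permutation of $\mathbb{F}_{2^m}^3$ if and only if $P_a'(T)=T^{q^2+q+1}+aT^{q^2+q}+1$ has no roots in $\mathbb{F}_{2^m}$.
   Context: $\mathbb{F}_{2^m}$ is the finite field with $2^m$ elements. *)

theory Defs
  imports "HOL-Computational_Algebra.Polynomial" "HOL-Library.Cardinality"
begin

definition H_map :: "nat \<Rightarrow> 'a::field \<Rightarrow> 'a \<times> 'a \<times> 'a \<Rightarrow> 'a \<times> 'a \<times> 'a" where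
  "H_map q a = (\<lambda>(x, y, z).
     (x ^ (q + 1) + a * x * y ^ q + y * z ^ q,
      x * y ^ q + z ^ (q + 1),
      x ^ q * z + y ^ (q + 1) + a * y ^ q * z))"

definition P'_poly :: "nat \<Rightarrow> 'a::field \<Rightarrow> 'a poly" where
  "P'_poly q a = monom 1 (q ^ 2 + q + 1) + monom a (q ^ 2 + q) + 1"

end

theory Submission
  imports Defs "HOL-Computational_Algebra.Primes"
begin

text \<open>
  With its components listed in reverse order, \<open>H_map q a v\<close> is the cross product
  \<open>v \<times> \<Phi> v\<close>, where \<open>\<Phi> (x, y, z) = (z\<^sup>q, x\<^sup>q + a y\<^sup>q, y\<^sup>q)\<close> is semilinear
  over the Frobenius map \<open>t \<mapsto> t\<^sup>q\<close>. Hence the nontrivial zeros of \<open>H_map q a\<close> are the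
  eigenvectors of \<open>\<Phi>\<close>, and these correspond to the roots of \<open>P'_poly q a\<close>.
  If \<open>v\<close> and \<open>v'\<close> have the same image \<open>w \<noteq> 0\<close>, then \<open>v\<close>, \<open>\<Phi> v\<close>, \<open>v'\<close>, \<open>\<Phi> v'\<close> all lie in
  the plane orthogonal to \<open>w\<close>. If \<open>v' = l v\<close>, then \<open>l\<^bsup>q+1\<^esup> = 1\<close> and so \<open>l = 1\<close>.
  Otherwise that plane is \<open>\<Phi>\<close>-invariant and, after rescaling \<open>w\<close>, the functional
  \<open>w \<bullet> _\<close> turns \<open>\<Phi> + 1\<close> into \<open>t \<mapsto> t\<^sup>q + t\<close>, which is not surjective. So \<open>\<Phi> + 1\<close> is
  not surjective, hence not injective, and \<open>\<Phi>\<close> has a nonzero fixed vector.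
\<close>

section \<open>Finite fields of characteristic 2\<close>

lemma finite_field_power_card:
  fixes x :: "'a::{field, finite}"
  shows "x ^ CARD('a) = x"
proof (cases "x = 0")
  case False
  \<comment> \<open>Multiplication by a nonzero \<open>x\<close> permutes the nonzero elements, so
    both products agree and can be cancelled.\<close>
  have "x * (\<Prod>y\<in>UNIV-{0}. x * y) = x * x ^ (CARD('a) - 1) * \<Prod>(UNIV-{0})"
    by (simp add: prod.distrib mult_ac)
  moreover have "x * x ^ (CARD('a) - 1) = x ^ CARD('a)"
    by (simp flip: power_Suc)
  moreover have "(\<Prod>y\<in>UNIV-{0}. x * y) = \<Prod>(UNIV-{0})"
    by (rule prod.reindex_bij_witness[of _ "\<lambda>y. y / x" "\<lambda>y. x * y"]) (use False in auto)
  ultimately have "x * \<Prod>(UNIV-{0}) = x ^ CARD('a) * \<Prod>(UNIV-{0})"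
    by (simp only:)
  thus ?thesis by simp
qed simp

lemma power_iterate:
  fixes x :: "'a::monoid_mult"
  assumes "x ^ k = x"
  shows "x ^ (k ^ n) = x"
  by (induction n) (simp_all add: assms power_mult)

context
  fixes m :: nat
  assumes card: "CARD('a::{field, finite}) = 2 ^ m"
    and m_pos: "m > 0"
begin

lemma minus_eq_self: "- x = (x :: 'a)"
proof -
  \<comment> \<open>The exponent is even because \<open>m > 0\<close>.\<close>
  have "(- 1 :: 'a) ^ CARD('a) = 1"
    using m_pos by (simp add: card)
  hence "- 1 = (1 :: 'a)"
    by (simp only: finite_field_power_card)
  thus ?thesis
    by (metis mult_minus1 mult_1)
qed

lemma add_self: "x + x = (0 :: 'a)"
  using minus_eq_self[of x] by (metis add.right_inverse)

lemma add_self_left: "x + (x + y) = (y :: 'a)"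
  by (simp add: add_self flip: add.assoc)

lemma add_eq_0_iff_eq: "x + y = 0 \<longleftrightarrow> x = (y :: 'a)"
  by (metis minus_eq_self add_eq_0_iff)

lemma frobenius_add: "(x + y :: 'a) ^ (2 ^ i) = x ^ (2 ^ i) + y ^ (2 ^ i)"
proof (induction i)
  case (Suc i)
  have "(u + v :: 'a) ^ 2 = u ^ 2 + v ^ 2" for u v
    by (simp add: power2_eq_square algebra_simps add_self_left)
  with Suc show ?case
    by (simp add: power_mult mult.commute[of 2])
qed simp

text \<open>By Bezout, \<open>k * s\<close> exceeds a multiple of \<open>m\<close> by one. Iterating
  the fixed power map \<open>s\<close> times therefore amounts to a single squaring, which gives
  \<open>x = x^2\<close>.\<close>

lemma frobenius_fixed:
  fixes x :: 'a
  assumes "coprime k m" "m \<noteq> 1" "x ^ (2 ^ k) = x"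
  shows "x = 0 \<or> x = 1"
proof -
  obtain s t where st: "k * s = m * t + 1"
    using coprime_bezout_strong[of k m] assms by blast
  have "x = x ^ (2 ^ (k * s))"
    using power_iterate[OF assms(3)] by (simp add: power_mult)
  also have "\<dots> = (x ^ (2 ^ (m * t))) ^ 2"
    unfolding st power_add power_mult by simp
  also have "x ^ (2 ^ (m * t)) = x"
    using power_iterate[OF finite_field_power_card[of x]] by (simp add: card power_mult)
  finally have "x * (x - 1) = 0"
    by (simp add: power2_eq_square algebra_simps)
  thus ?thesis by simp
qed

end

section \<open>Cross products in dimension 3\<close>

lemma orthogonal_to_both:
  fixes x1 x2 x3 :: "'a::field"
  assumes "x1 * u1 + x2 * u2 + x3 * u3 = 0" "x1 * v1 + x2 * v2 + x3 * v3 = 0"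
    and n: "n1 = u2 * v3 - u3 * v2" "n2 = u3 * v1 - u1 * v3" "n3 = u1 * v2 - u2 * v1"
    and nz: "(n1, n2, n3) \<noteq> (0, 0, 0)"
  shows "\<exists>k. x1 = k * n1 \<and> x2 = k * n2 \<and> x3 = k * n3"
proof -
  \<comment> \<open>With n = u \<times> v, the triple product x \<times> n is a combination of u and
    v with coefficients x \<bullet> v and x \<bullet> u, hence zero.\<close>
  have *: "x1 * n2 = x2 * n1" "x1 * n3 = x3 * n1" "x2 * n3 = x3 * n2"
    using assms(1,2) unfolding n by algebra+
  consider "n1 \<noteq> 0" | "n2 \<noteq> 0" | "n3 \<noteq> 0" using nz by auto
  thus ?thesis
  proof cases
    case 1 thus ?thesis using * by (intro exI[of _ "x1 / n1"]) (simp add: field_simps)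
  next
    case 2 thus ?thesis using * by (intro exI[of _ "x2 / n2"]) (simp add: field_simps)
  next
    case 3 thus ?thesis using * by (intro exI[of _ "x3 / n3"]) (simp add: field_simps)
  qed
qed

lemma cross_product_eq_0:
  fixes u1 u2 u3 :: "'a::field"
  assumes "u2 * v3 = u3 * v2" "u3 * v1 = u1 * v3" "u1 * v2 = u2 * v1"
    and "(u1, u2, u3) \<noteq> (0, 0, 0)"
  shows "\<exists>l. v1 = l * u1 \<and> v2 = l * u2 \<and> v3 = l * u3"
proof -
  consider "u1 \<noteq> 0" | "u2 \<noteq> 0" | "u3 \<noteq> 0" using assms(4) by auto
  thus ?thesis
  proof cases
    case 1 thus ?thesis using assms by (intro exI[of _ "v1 / u1"]) (simp add: field_simps)
  next
    case 2 thus ?thesis using assms by (intro exI[of _ "v2 / u2"]) (simp add: field_simps)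
  next
    case 3 thus ?thesis using assms by (intro exI[of _ "v3 / u3"]) (simp add: field_simps)
  qed
qed

lemma H_map_zero:
  assumes "q > 0"
  shows "H_map q a (0, 0, 0) = (0, 0, 0)"
  using assms by (simp add: H_map_def)

lemma poly_P': "poly (P'_poly q a) t = t ^ (q\<^sup>2 + q + 1) + a * t ^ (q\<^sup>2 + q) + 1"
  by (simp add: P'_poly_def poly_monom)

section \<open>The power map t \<mapsto> t^q and the semilinear map \<open>\<Phi>\<close>\<close>

context
  fixes m i q :: nat and a :: "'a::{field, finite}"
  assumes m: "m \<ge> 3" "odd m"
    and card: "CARD('a) = 2 ^ m"
    and q: "q = 2 ^ i" and gcd: "gcd i m = 1"
begin

lemma m_pos: "m > 0" using m by simp

lemma q_pos: "q > 0" using q by simp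

lemma coprime_i_m: "coprime i m" using gcd by (simp only: coprime_iff_gcd_eq_1)

lemmas add_self' = add_self[OF card m_pos] add_self_left[OF card m_pos]

lemma power_q_add: "(x + y :: 'a) ^ q = x ^ q + y ^ q"
  using frobenius_add[OF card m_pos] q by simp

lemma power_q_fixed: "(x :: 'a) ^ q = x \<Longrightarrow> x = 0 \<or> x = 1"
  using frobenius_fixed[OF card m_pos, of i x] m coprime_i_m q by simp

text \<open>Raising to the power \<open>q\<close> inverts \<open>x\<close>, so doing it twice fixes
  \<open>x\<close>. As \<open>m\<close> is odd, \<open>2 * i\<close> is still coprime to
  \<open>m\<close>, and \<open>x\<close> must lie in the prime field.\<close>

lemma power_Suc_q_eq_1:
  assumes "(x :: 'a) ^ (q + 1) = 1"
  shows "x = 1"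
proof -
  have "x \<noteq> 0" using assms by auto
  have "x ^ q = inverse x"
    using assms \<open>x \<noteq> 0\<close> by (simp add: field_simps)
  hence "(x ^ q) ^ q = x"
    by (simp add: power_inverse)
  moreover have "(x ^ q) ^ q = x ^ (2 ^ (2 * i))"
    by (simp add: q power_mult[symmetric] mult_2 power_add)
  moreover have "coprime (2 * i) m"
    using m coprime_i_m by simp
  ultimately show ?thesis
    using frobenius_fixed[OF card m_pos, of "2 * i" x] m \<open>x \<noteq> 0\<close> by auto
qed

text \<open>On nonzero elements u \<mapsto> u^(q-1) is injective, hence onto by finiteness. This
  supplies the scalars that normalise eigenvalues of \<open>\<Phi>\<close> to 1.\<close>

lemma power_q_eq_mult:
  assumes "(c :: 'a) \<noteq> 0"
  shows "\<exists>u. u \<noteq> 0 \<and> u ^ q = c * u"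
proof -
  have "inj_on (\<lambda>u::'a. u ^ q / u) (- {0})"
  proof (rule inj_onI)
    fix u v :: 'a
    assume uv: "u \<in> - {0}" "v \<in> - {0}" "u ^ q / u = v ^ q / v"
    hence "(u / v) ^ q = u / v"
      by (simp add: field_simps)
    with power_q_fixed[of "u / v"] uv show "u = v" by auto
  qed
  moreover have "(\<lambda>u::'a. u ^ q / u) ` (- {0}) \<subseteq> - {0}" by auto
  ultimately have "(\<lambda>u::'a. u ^ q / u) ` (- {0}) = - {0}"
    by (intro endo_inj_surj) auto
  with assms obtain u where "u \<noteq> 0" "c = u ^ q / u" by blast
  thus ?thesis by (intro exI[of _ u]) simp
qed

text \<open>The conditions on r say precisely that r \<bullet> \<open>\<Phi>\<close> v = (r
  \<bullet> v)^q for all v.\<close>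

lemma fixed_vector_of_invariant_functional:
  assumes nz: "(r1, r2, r3) \<noteq> (0, 0, 0 :: 'a)"
    and r: "r2 = r1 ^ q" "a * r2 + r3 = r2 ^ q" "r1 = r3 ^ q"
  shows "\<exists>x y z. (x, y, z) \<noteq> (0, 0, 0) \<and> z ^ q = x \<and> x ^ q + a * y ^ q = y \<and> y ^ q = z"
proof -
  \<comment> \<open>This is \<open>\<Phi>\<close> + 1, an additive map whose kernel consists of the
    fixed vectors of \<open>\<Phi>\<close>.\<close>
  define g :: "'a \<times> 'a \<times> 'a \<Rightarrow> 'a \<times> 'a \<times> 'a"
    where "g = (\<lambda>(x, y, z). (z ^ q + x, x ^ q + a * y ^ q + y, y ^ q + z))"
  have "\<not> surj (\<lambda>t::'a. t ^ q + t)"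
  proof
    assume "surj (\<lambda>t::'a. t ^ q + t)"
    hence "inj (\<lambda>t::'a. t ^ q + t)"
      by (simp add: finite_UNIV_surj_inj)
    from injD[OF this, of 0 1] show False
      using q_pos by (simp add: add_self')
  qed
  then obtain s :: 'a where s: "\<And>t. t ^ q + t \<noteq> s"
    unfolding surj_def by metis
  obtain b1 b2 b3 where b: "r1 * b1 + r2 * b2 + r3 * b3 = s"
  proof -
    consider "r1 \<noteq> 0" | "r2 \<noteq> 0" | "r3 \<noteq> 0" using nz by auto
    thus ?thesis
    proof cases
      case 1 with that[of "s / r1" 0 0] show ?thesis by simp
    next
      case 2 with that[of 0 "s / r2" 0] show ?thesis by simp
    next
      case 3 with that[of 0 0 "s / r3"] show ?thesis by simp
    qed
  qed
  \<comment> \<open>Applying r to \<open>g v = b\<close> would express \<open>s\<close> as t^q + t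
    with t = r \<bullet> v.\<close>
  have "g v \<noteq> (b1, b2, b3)" for v
  proof
    assume gv: "g v = (b1, b2, b3)"
    obtain x y z where v: "v = (x, y, z)" by (cases v)
    have "s = r1 * z ^ q + r2 * x ^ q + (a * r2 + r3) * y ^ q + (r1 * x + r2 * y + r3 * z)"
      using gv unfolding b[symmetric] g_def v by (auto simp: algebra_simps)
    also have "\<dots> = (r1 * x + r2 * y + r3 * z) ^ q + (r1 * x + r2 * y + r3 * z)"
      by (subst r(2), subst (1) r(3), subst (1) r(1))
         (simp add: power_q_add power_mult_distrib add_ac)
    finally show False using s by metis
  qed
  hence "\<not> surj g" by (metis surjD)
  hence "\<not> inj g"
    using finite_UNIV_inj_surj[of g] by auto
  then obtain u v where uv: "u \<noteq> v" "g u = g v"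
    unfolding inj_def by blast
  obtain x y z where u: "u = (x, y, z)" by (cases u)
  obtain x' y' z' where v: "v = (x', y', z')" by (cases v)
  note iff = add_eq_0_iff_eq[OF card m_pos]
  \<comment> \<open>In characteristic 2 this sum is the difference of two vectors with equal image,
    so it lies in the kernel of \<open>g\<close>.\<close>
  have "(x + x', y + y', z + z') \<noteq> (0, 0, 0)"
    using uv(1) by (auto simp: u v iff)
  moreover have "z ^ q + x = z' ^ q + x'" "x ^ q + a * y ^ q + y = x' ^ q + a * y' ^ q + y'"
    "y ^ q + z = y' ^ q + z'"
    using uv(2) by (simp_all add: g_def u v)
  hence "(z ^ q + z' ^ q) + (x + x') = 0"
    "(x ^ q + x' ^ q + a * (y ^ q + y' ^ q)) + (y + y') = 0"
    "(y ^ q + y' ^ q) + (z + z') = 0"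
    unfolding iff[symmetric, of "_ + _" "_ + _"] by (simp_all add: algebra_simps)
  hence "(z + z') ^ q = x + x'" "(x + x') ^ q + a * (y + y') ^ q = y + y'"
    "(y + y') ^ q = z + z'"
    by (simp_all add: iff power_q_add)
  ultimately show ?thesis by blast
qed

text \<open>The root is \<open>y / z\<close>: the fixed-vector equations turn its
  \<open>q\<close>-th power into \<open>z / x\<close> and its q^2-th power into
  \<open>x / x ^ q\<close>.\<close>

lemma root_of_fixed_vector:
  assumes nz: "(x, y, z) \<noteq> (0, 0, 0 :: 'a)"
    and fixed: "z ^ q = x" "x ^ q + a * y ^ q = y" "y ^ q = z"
  shows "\<exists>t. poly (P'_poly q a) t = 0"
proof -
  have y: "y \<noteq> 0" using nz fixed q_pos by auto
  hence z: "z \<noteq> 0" using fixed(3) by auto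
  hence x: "x \<noteq> 0" using fixed(1) by auto
  have t1: "(y / z) ^ q = z / x"
    using fixed by (simp add: power_divide)
  have "(y / z) ^ (q\<^sup>2) = ((y / z) ^ q) ^ q"
    by (simp only: power_mult power2_eq_square)
  also have "\<dots> = (z / x) ^ q"
    by (simp only: t1)
  also have "\<dots> = x / x ^ q"
    by (simp add: power_divide fixed(1))
  finally have t2: "(y / z) ^ (q\<^sup>2) = x / x ^ q" .
  have "poly (P'_poly q a) (y / z) = x / x ^ q * (z / x) * (y / z) + a * (x / x ^ q * (z / x)) + 1"
    by (simp only: poly_P' power_add t1 t2 power_one_right)
  also have "\<dots> = (y + a * z + x ^ q) / x ^ q"
    using x z by (simp add: field_simps)
  also have "y + a * z + x ^ q = y + y"
    using fixed(2,3) by (metis add.assoc add.commute)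
  finally show ?thesis
    by (auto simp: add_self')
qed

lemma H_map_eq_0_of_root:
  assumes "poly (P'_poly q a) t = 0"
  shows "\<exists>v. v \<noteq> (0, 0, 0) \<and> H_map q a v = (0, 0, 0)"
proof -
  have t: "t ^ (q\<^sup>2 + q + 1) + a * t ^ (q\<^sup>2 + q) + 1 = 0"
    using assms by (simp only: poly_P')
  have "t \<noteq> 0" using t q_pos by (auto simp: power_0_left)
  \<comment> \<open>Normalising \<open>y = 1\<close>, the second component vanishes for x = z^(q+1).
    The other two then reduce to the reciprocal polynomial of \<open>P'_poly q a\<close> at
    \<open>z\<close>.\<close>
  define z where "z = inverse t"
  have "z ^ (q\<^sup>2 + q + 1) * (t ^ (q\<^sup>2 + q + 1) + a * t ^ (q\<^sup>2 + q) + 1) =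
      1 + a * z + z ^ (q\<^sup>2 + q + 1)"
    using \<open>t \<noteq> 0\<close> unfolding z_def by (simp add: field_simps power_add)
  hence z: "1 + a * z + z ^ (q\<^sup>2 + q + 1) = 0"
    using t by simp
  have e: "(z * z ^ q) ^ q * z = z ^ (q\<^sup>2 + q + 1)"
    by (simp add: power_mult_distrib power_add power_mult power2_eq_square)
  have "(z * z ^ q) ^ q * (z * z ^ q) + a * (z * z ^ q) + z ^ q
      = z ^ q * (1 + a * z + z ^ (q\<^sup>2 + q + 1))"
    unfolding e[symmetric] by (simp add: algebra_simps)
  moreover have "(z * z ^ q) ^ q * z + 1 + a * z = 1 + a * z + z ^ (q\<^sup>2 + q + 1)"
    unfolding e by simp
  ultimately have "H_map q a (z * z ^ q, 1, z) = (0, 0, 0)"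
    unfolding z by (simp add: H_map_def add_self' mult_ac)
  thus ?thesis by (intro exI[of _ "(z * z ^ q, 1, z)"]) simp
qed

text \<open>A cross product is orthogonal to both factors, here v and \<open>\<Phi>\<close> v. The
  second equation is regrouped as a functional of \<open>(x ^ q, y ^ q, z ^ q)\<close>.\<close>

lemma H_map_orthogonal:
  assumes "H_map q a (x, y, z) = (w3, w2, w1)"
  shows "w1 * x + w2 * y + w3 * z = 0"
    and "w2 * x ^ q + (a * w2 + w3) * y ^ q + w1 * z ^ q = 0"
  using assms by (auto simp: H_map_def algebra_simps add_self')

lemma root_of_H_map_eq_0:
  assumes "H_map q a (x, y, z) = (0, 0, 0)" "(x, y, z) \<noteq> (0, 0, 0)"
  shows "\<exists>t. poly (P'_poly q a) t = 0"
proof -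
  note iff = add_eq_0_iff_eq[OF card m_pos]
  have "y * y ^ q + z * (x ^ q + a * y ^ q) = 0" "z * z ^ q + x * y ^ q = 0"
    "x * (x ^ q + a * y ^ q) + y * z ^ q = 0"
    using assms(1) by (simp_all add: H_map_def algebra_simps)
  then obtain l where l: "z ^ q = l * x" "x ^ q + a * y ^ q = l * y" "y ^ q = l * z"
    unfolding iff using cross_product_eq_0[OF _ _ _ assms(2)] by blast
  have "l \<noteq> 0"
    using l assms(2) q_pos by auto
  \<comment> \<open>Since \<open>\<Phi>\<close> v = l v, the vector u v satisfies
    \<open>\<Phi>\<close> (u v) = u^q l v, which equals u v for this choice of
    \<open>u\<close>.\<close>
  then obtain u where u: "u \<noteq> 0" "u ^ q = inverse l * u"
    using power_q_eq_mult[of "inverse l"] by auto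
  show ?thesis
  proof (rule root_of_fixed_vector)
    show "(u * x, u * y, u * z) \<noteq> (0, 0, 0)" using u assms(2) by auto
    show "(u * z) ^ q = u * x" "(u * y) ^ q = u * z"
      using l \<open>l \<noteq> 0\<close> by (simp_all add: power_mult_distrib u)
    have "(u * x) ^ q + a * (u * y) ^ q = u ^ q * (x ^ q + a * y ^ q)"
      by (simp add: power_mult_distrib algebra_simps)
    thus "(u * x) ^ q + a * (u * y) ^ q = u * y"
      using l \<open>l \<noteq> 0\<close> by (simp add: u)
  qed
qed

section \<open>Injectivity of \<open>H_map q a\<close>\<close>

lemma H_map_scale:
  assumes "H_map q a (x, y, z) = (p1, p2, p3)"
  shows "H_map q a (l * x, l * y, l * z) = (l ^ (q + 1) * p1, l ^ (q + 1) * p2, l ^ (q + 1) * p3)"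
  using assms by (auto simp: H_map_def power_mult_distrib algebra_simps)

lemma root_of_invariant_plane:
  assumes H: "H_map q a (x, y, z) = (w3, w2, w1)" "H_map q a (x', y', z') = (w3, w2, w1)"
    and w: "(w1, w2, w3) \<noteq> (0, 0, 0)"
    and n: "n1 = y * z' - z * y'" "n2 = z * x' - x * z'" "n3 = x * y' - y * x'"
    and nz: "(n1, n2, n3) \<noteq> (0, 0, 0)"
  shows "\<exists>t. poly (P'_poly q a) t = 0"
proof -
  have diff: "(u - v) ^ q = u ^ q - v ^ q" for u v :: 'a
    using power_q_add[of "u - v" v] by simp
  obtain k where k: "w1 = k * n1" "w2 = k * n2" "w3 = k * n3"
    using orthogonal_to_both[OF H_map_orthogonal(1)[OF H(1)] H_map_orthogonal(1)[OF H(2)] n nz]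
    by blast
  have "k \<noteq> 0" using k w by auto
  have nq: "(n1 ^ q, n2 ^ q, n3 ^ q) \<noteq> (0, 0, 0)" using nz by auto
  have nq_eq: "n1 ^ q = y ^ q * z' ^ q - z ^ q * y' ^ q" "n2 ^ q = z ^ q * x' ^ q - x ^ q * z' ^ q"
    "n3 ^ q = x ^ q * y' ^ q - y ^ q * x' ^ q"
    by (simp_all add: n diff power_mult_distrib)
  \<comment> \<open>The functional w \<bullet> \<open>\<Phi>\<close> _, read in the
    \<open>q\<close>-th powers of the coordinates, kills the powers of both vectors, so it is a
    multiple of their cross product.\<close>
  obtain j where j: "w2 = j * n1 ^ q" "a * w2 + w3 = j * n2 ^ q" "w1 = j * n3 ^ q"
    using orthogonal_to_both[OF H_map_orthogonal(2)[OF H(1)] H_map_orthogonal(2)[OF H(2)] nq_eq nq]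
    by blast
  define c where "c = j / k ^ q"
  have "c * w1 ^ q = j * n1 ^ q" "c * w2 ^ q = j * n2 ^ q" "c * w3 ^ q = j * n3 ^ q"
    using \<open>k \<noteq> 0\<close> by (simp_all add: c_def k power_mult_distrib)
  hence c: "w2 = c * w1 ^ q" "a * w2 + w3 = c * w2 ^ q" "w1 = c * w3 ^ q"
    by (simp_all only: j[symmetric])
  have "c \<noteq> 0" using c w by auto
  \<comment> \<open>So far w \<bullet> \<open>\<Phi>\<close> v = c (w \<bullet> v)^q; replacing w by
    u w absorbs the factor \<open>c\<close>.\<close>
  then obtain u where u: "u \<noteq> 0" "u ^ q = c * u"
    using power_q_eq_mult by blast
  have "u * w2 = (u * w1) ^ q"
    unfolding power_mult_distrib u(2) using c(1) by (simp add: mult_ac)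
  moreover have "a * (u * w2) + u * w3 = (u * w2) ^ q"
  proof -
    have "a * (u * w2) + u * w3 = u * (a * w2 + w3)" by (simp add: algebra_simps)
    thus ?thesis unfolding c(2) power_mult_distrib u(2) by (simp only: mult_ac)
  qed
  moreover have "u * w1 = (u * w3) ^ q"
    unfolding power_mult_distrib u(2) using c(3) by (simp add: mult_ac)
  moreover have "(u * w1, u * w2, u * w3) \<noteq> (0, 0, 0)" using u w by auto
  ultimately show ?thesis
    using fixed_vector_of_invariant_functional[of "u * w1" "u * w2" "u * w3"] root_of_fixed_vector
    by blast
qed

lemma inj_H_map:
  assumes no_root: "\<nexists>t. poly (P'_poly q a) t = 0"
  shows "inj (H_map q a)"
proof (rule injI)
  fix v v' :: "'a \<times> 'a \<times> 'a"
  assume eq: "H_map q a v = H_map q a v'"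
  obtain x y z where v: "v = (x, y, z)" by (cases v)
  obtain x' y' z' where v': "v' = (x', y', z')" by (cases v')
  obtain w1 w2 w3 where H: "H_map q a v = (w3, w2, w1)" by (cases "H_map q a v")
  show "v = v'"
  proof (cases "(w1, w2, w3) = (0, 0, 0)")
    case True
    hence "H_map q a (x, y, z) = (0, 0, 0)" "H_map q a (x', y', z') = (0, 0, 0)"
      using H eq v v' by auto
    thus ?thesis
      using root_of_H_map_eq_0 no_root v v' by metis
  next
    case w: False
    have "(y * z' - z * y', z * x' - x * z', x * y' - y * x') = (0, 0, 0)"
      using root_of_invariant_plane[OF _ _ w refl refl refl] H eq v v' no_root by metis
    moreover have v_nz: "(x, y, z) \<noteq> (0, 0, 0)"
      using H w v H_map_zero[OF q_pos, of a] by auto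
    ultimately obtain l where l: "x' = l * x" "y' = l * y" "z' = l * z"
      using cross_product_eq_0[of y z' z y' x' x] by auto
    \<comment> \<open>Proportional vectors have images differing by the factor l^(q+1); the common
      image is nonzero, so this factor is 1.\<close>
    have "(w3, w2, w1) = (l ^ (q + 1) * w3, l ^ (q + 1) * w2, l ^ (q + 1) * w1)"
      using H_map_scale[of x y z w3 w2 w1 l] H eq v v' l by simp
    hence "l ^ (q + 1) = 1" using w by auto
    hence "l = 1" by (rule power_Suc_q_eq_1)
    thus ?thesis using l v v' by simp
  qed
qed

end

theorem theorem3p3:
  fixes a :: "'a::{field, finite}" and m i q :: nat
  assumes "m \<ge> 3" and "odd m"
    and "CARD('a) = 2 ^ m"
    and "q = 2 ^ i" and "gcd i m = 1"
    and "a \<noteq> 0"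
  shows "bij (H_map q a) \<longleftrightarrow> (\<nexists>t. poly (P'_poly q a) t = 0)"
proof
  note H_zero = H_map_zero[OF q_pos[OF assms(1-5)], of a]
  assume "bij (H_map q a)"
  thus "\<nexists>t. poly (P'_poly q a) t = 0"
    using H_map_eq_0_of_root[OF assms(1-5)] H_zero by (metis bij_is_inj injD)
next
  assume "\<nexists>t. poly (P'_poly q a) t = 0"
  hence "inj (H_map q a)"
    by (rule inj_H_map[OF assms(1-5)])
  thus "bij (H_map q a)"
    by (simp add: bij_def finite_UNIV_inj_surj)
qed

end
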